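(* Let $d\ge 1$ and $N\ge 1$. Consider the following decision problem. The input consists of real numbers $a^{(j)}_i<b^{(j)}_i$ for $i=0,1,\dots,N$ and $j=1,\dots,d$, satisfying $a^{(j)}_0\le a^{(j)}_i<b^{(j)}_i\le b^{(j)}_0$ for all $i=1,\dots,N$ and all $j$. Thus $R_i=\prod_{j=1}^d[a^{(j)}_i,b^{(j)}_i]$, $i=1,\dots,N$, are boxes contained in the box $R_0=\prod_{j=1}^d[a^{(j)}_0,b^{(j)}_0]$. The question is whether $\bigcup_{i=1}^N R_i=R_0$. An algorithm accesses the input only through queries. A query picks two endpoints belonging to the same coordinate $j$, i.e. two elements of $X_j=\{a^{(j)}_0,\dots,a^{(j)}_N,b^{(j)}_0,\dots,b^{(j)}_N\}$, and receives the answer to which of $x<x'$, $x=x'$, $x>x'$ holds. The algorithm is adaptive: the choice of each query may depend on the answers to earlier queries. It must decide correctly, for every admissible input, whether $\bigcup_{i=1}^N R_i=R_0$. Then, already for $d=1$ (and hence for every $d\ge1$), $O(N)$ queries do not suffice. More precisely, the worst-case number of queries required by any such algorithm is $\Omega(N\log N)$ as $N\to\infty$.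
   Context: The worst case is taken over all admissible inputs. $\Omega(N\log N)$ means that there is a constant $c>0$ such that, for all sufficiently large $N$, every correct algorithm uses at least $cN\log N$ queries on some input. *)

theory Defs
  imports "HOL-Analysis.Analysis"
begin

text \<open>
  An input is a pair of families \<open>a, b :: nat \<Rightarrow> real ^ 'd\<close>, with \<open>a i $ j\<close> and \<open>b i $ j\<close> the
  endpoints of box \<open>i\<close> in coordinate \<open>j\<close>; the dimension is \<open>CARD('d)\<close>. Index \<open>0\<close> is the
  enclosing box, and values at indices beyond \<open>N\<close> are not part of the input.
\<close>

definition admissible :: "nat \<Rightarrow> (nat \<Rightarrow> real ^ 'd) \<Rightarrow> (nat \<Rightarrow> real ^ 'd) \<Rightarrow> bool" where
  "admissible N a b \<longleftrightarrow>
     (\<forall>i\<in>{0..N}. \<forall>j. a i $ j < b i $ j) \<and>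
     (\<forall>i\<in>{1..N}. \<forall>j. a 0 $ j \<le> a i $ j \<and> b i $ j \<le> b 0 $ j)"

definition covers :: "nat \<Rightarrow> (nat \<Rightarrow> real ^ 'd) \<Rightarrow> (nat \<Rightarrow> real ^ 'd) \<Rightarrow> bool" where
  "covers N a b \<longleftrightarrow> (\<Union>i\<in>{1..N}. cbox (a i) (b i)) = cbox (a 0) (b 0)"

datatype endpoint = Lower (box_index: nat) | Upper (box_index: nat)

fun endpoint_value :: "(nat \<Rightarrow> real ^ 'd) \<Rightarrow> (nat \<Rightarrow> real ^ 'd) \<Rightarrow> 'd \<Rightarrow> endpoint \<Rightarrow> real" where
  "endpoint_value a b j (Lower i) = a i $ j"
| "endpoint_value a b j (Upper i) = b i $ j"

datatype answer = Less | Equal | Greater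

definition compare_reals :: "real \<Rightarrow> real \<Rightarrow> answer" where
  "compare_reals x y = (if x < y then Less else if x = y then Equal else Greater)"

text \<open>
  An adaptive algorithm for a fixed number \<open>N\<close> of boxes is a ternary decision tree: it either stops
  with a verdict, or compares two endpoints in one coordinate and continues with the subtree
  selected by the answer. No uniformity in \<open>N\<close> is imposed, and computation between queries is
  free of charge.
\<close>

datatype 'd algorithm =
  Stop bool
| Query 'd endpoint endpoint "answer \<Rightarrow> 'd algorithm"

primrec valid_queries :: "nat \<Rightarrow> 'd algorithm \<Rightarrow> bool" where
  "valid_queries N (Stop v) \<longleftrightarrow> True"
| "valid_queries N (Query j x y next) \<longleftrightarrow>
     box_index x \<le> N \<and> box_index y \<le> N \<and> (\<forall>r. valid_queries N (next r))"

primrec verdict :: "'d algorithm \<Rightarrow> (nat \<Rightarrow> real ^ 'd) \<Rightarrow> (nat \<Rightarrow> real ^ 'd) \<Rightarrow> bool" where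
  "verdict (Stop v) a b = v"
| "verdict (Query j x y next) a b =
     verdict (next (compare_reals (endpoint_value a b j x) (endpoint_value a b j y))) a b"

primrec num_queries :: "'d algorithm \<Rightarrow> (nat \<Rightarrow> real ^ 'd) \<Rightarrow> (nat \<Rightarrow> real ^ 'd) \<Rightarrow> nat" where
  "num_queries (Stop v) a b = 0"
| "num_queries (Query j x y next) a b =
     Suc (num_queries (next (compare_reals (endpoint_value a b j x) (endpoint_value a b j y))) a b)"

definition correct_algorithm :: "nat \<Rightarrow> 'd::finite algorithm \<Rightarrow> bool" where
  "correct_algorithm N T \<longleftrightarrow>
     valid_queries N T \<and> (\<forall>a b. admissible N a b \<longrightarrow> (verdict T a b \<longleftrightarrow> covers N a b))"

end

theory Submission
  imports Defs "HOL-Combinatorics.Permutations" "HOL-Real_Asymp.Real_Asymp"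
begin

text \<open>
  For a permutation \<open>p\<close> of \<open>{1..N}\<close>, let box \<open>i\<close> be the slab \<open>p i - 1 \<le> x $ j \<le> p i\<close> of the cube
  \<open>[0, N]\<^sup>d\<close>; these boxes cover it. If two inputs yield the same answers, then so does their
  midpoint, because comparisons are preserved by averaging. For distinct permutations the midpoint
  is not a covering: at the least position \<open>k\<close> where they disagree, no box meets the hyperplane
  \<open>x $ j = k - 3/4\<close>. Hence the \<open>N!\<close> permutations have pairwise distinct answer sequences, and some
  sequence has length of order \<open>ln (N!)\<close>.
\<close>

section \<open>Answer sequences of a decision tree\<close>

text \<open>Only the answers are recorded: the tree is deterministic, so they fix every query asked
  and the leaf reached.\<close>

primrec transcript ::
  "'d algorithm \<Rightarrow> (nat \<Rightarrow> real ^ 'd) \<Rightarrow> (nat \<Rightarrow> real ^ 'd) \<Rightarrow> answer list" where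
  "transcript (Stop v) a b = []"
| "transcript (Query j x y cont) a b =
     (let r = compare_reals (endpoint_value a b j x) (endpoint_value a b j y)
      in r # transcript (cont r) a b)"

lemma length_transcript: "length (transcript T a b) = num_queries T a b"
  by (induction T) (auto simp: Let_def)

lemma verdict_eq_if_transcript_eq:
  "transcript T a b = transcript T a' b' \<Longrightarrow> verdict T a b = verdict T a' b'"
proof (induction T)
  case (Query j x y cont)
  then show ?case by (auto simp: Let_def)
qed simp

section \<open>Midpoints of inputs\<close>

definition midpoint_family :: "(nat \<Rightarrow> real ^ 'd) \<Rightarrow> (nat \<Rightarrow> real ^ 'd) \<Rightarrow> nat \<Rightarrow> real ^ 'd" where
  "midpoint_family a a' i = midpoint (a i) (a' i)"

lemma midpoint_family_nth: "midpoint_family a a' i $ j = (a i $ j + a' i $ j) / 2"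
  by (simp add: midpoint_family_def midpoint_def)

lemma endpoint_value_midpoint_family:
  "endpoint_value (midpoint_family a a') (midpoint_family b b') j x =
     (endpoint_value a b j x + endpoint_value a' b' j x) / 2"
  by (cases x) (auto simp: midpoint_family_nth)

lemma compare_reals_midpoint:
  "compare_reals x y = compare_reals x' y' \<Longrightarrow>
     compare_reals ((x + x') / 2) ((y + y') / 2) = compare_reals x y"
  by (auto simp: compare_reals_def split: if_splits)

text \<open>Induction along the path: an answer shared by both inputs is also the answer at the
  midpoint, so all three descend into the same subtree.\<close>

lemma transcript_midpoint_family:
  "transcript T a b = transcript T a' b' \<Longrightarrow>
     transcript T (midpoint_family a a') (midpoint_family b b') = transcript T a b"
proof (induction T)
  case (Query j x y cont)
  then show ?case
    by (auto simp: Let_def endpoint_value_midpoint_family compare_reals_midpoint)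
qed simp

lemma admissible_midpoint_family:
  assumes "admissible N a b" "admissible N a' b'"
  shows "admissible N (midpoint_family a a') (midpoint_family b b')"
  using assms unfolding admissible_def midpoint_family_nth
  by (auto intro!: divide_strict_right_mono divide_right_mono add_strict_mono add_mono)

section \<open>Slab inputs from permutations\<close>

text \<open>Index \<open>0\<close> is exempted because it is the enclosing cube. Outside
  \<open>j0\<close> all boxes have full width, which leaves unit intervals on a line.\<close>

definition slab_lower :: "'d \<Rightarrow> (nat \<Rightarrow> nat) \<Rightarrow> nat \<Rightarrow> real ^ 'd" where
  "slab_lower j0 p i = (\<chi> j. if i \<noteq> 0 \<and> j = j0 then real (p i) - 1 else 0)"

definition slab_upper :: "nat \<Rightarrow> 'd \<Rightarrow> (nat \<Rightarrow> nat) \<Rightarrow> nat \<Rightarrow> real ^ 'd" where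
  "slab_upper N j0 p i = (\<chi> j. if i \<noteq> 0 \<and> j = j0 then real (p i) else real N)"

lemma admissible_slabs:
  assumes "p permutes {1..N}" "N \<ge> 1"
  shows "admissible N (slab_lower j0 p) (slab_upper N j0 p)"
proof -
  have "1 \<le> p i \<and> p i \<le> N" if "i \<in> {1..N}" for i
    using permutes_in_image[OF assms(1), of i] that by auto
  then show ?thesis
    using assms(2) by (auto simp: admissible_def slab_lower_def slab_upper_def)
qed

lemma covers_slabs:
  assumes p: "p permutes {1..N}" and N: "N \<ge> 1"
  shows "covers N (slab_lower j0 p) (slab_upper N j0 p)"
  unfolding covers_def
proof (intro equalityI subsetI)
  fix x assume "x \<in> (\<Union>i\<in>{1..N}. cbox (slab_lower j0 p i) (slab_upper N j0 p i))"
  then obtain i where i: "i \<in> {1..N}" "x \<in> cbox (slab_lower j0 p i) (slab_upper N j0 p i)"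
    by blast
  then show "x \<in> cbox (slab_lower j0 p 0) (slab_upper N j0 p 0)"
    using admissible_slabs[OF p N, of j0] unfolding admissible_def mem_box_cart
    by (meson order_trans)
next
  fix x assume x: "x \<in> cbox (slab_lower j0 p 0) (slab_upper N j0 p 0)"
  then have x_bounds: "0 \<le> x $ j" "x $ j \<le> real N" for j
    by (auto simp: mem_box_cart slab_lower_def slab_upper_def)
  \<comment> \<open>Rounding up finds the slab; the \<open>max\<close> sends
    \<open>x $ j0 = 0\<close> to slab position \<open>1\<close>.\<close>
  define k where "k = max 1 (nat \<lceil>x $ j0\<rceil>)"
  have k: "k \<in> {1..N}" "real k - 1 \<le> x $ j0" "x $ j0 \<le> real k"
    using x_bounds[of j0] N unfolding k_def by (auto simp: max_def) linarith+
  then obtain i where i: "i \<in> {1..N}" "p i = k"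
    using permutes_image[OF p] by (metis imageE)
  then have "x \<in> cbox (slab_lower j0 p i) (slab_upper N j0 p i)"
    using k x_bounds by (auto simp: mem_box_cart slab_lower_def slab_upper_def)
  with i show "x \<in> (\<Union>i\<in>{1..N}. cbox (slab_lower j0 p i) (slab_upper N j0 p i))"
    by blast
qed

lemma not_covers_midpoint_slabs:
  assumes p: "p permutes {1..N}" and q: "q permutes {1..N}" and "p \<noteq> q"
  shows "\<not> covers N (midpoint_family (slab_lower j0 p) (slab_lower j0 q))
                    (midpoint_family (slab_upper N j0 p) (slab_upper N j0 q))"
    (is "\<not> covers N ?a ?b")
proof
  assume cov: "covers N ?a ?b"
  define k where "k = (LEAST k. \<exists>i. p i \<noteq> q i \<and> (k = p i \<or> k = q i))"
  have ex: "\<exists>k i. p i \<noteq> q i \<and> (k = p i \<or> k = q i)"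
    using \<open>p \<noteq> q\<close> by blast
  obtain i0 where i0: "p i0 \<noteq> q i0" "k = p i0 \<or> k = q i0"
    using LeastI_ex[OF ex] unfolding k_def by blast
  have least: "k \<le> p i" "k \<le> q i" if "p i \<noteq> q i" for i
    using that unfolding k_def by (auto intro!: Least_le)
  have "i0 \<in> {1..N}"
    using i0(1) p q by (metis permutes_not_in)
  then have k: "1 \<le> k" "k \<le> N"
    using i0(2) permutes_in_image[OF p, of i0] permutes_in_image[OF q, of i0] by auto
  \<comment> \<open>Along \<open>j0\<close>, an averaged slab with \<open>p i \<noteq> q i\<close>
    starts at \<open>k - 1/2\<close> or later, and one with \<open>p i = q i < k\<close> ends by
    \<open>k - 1\<close>. The point lies strictly between.\<close>
  define x :: "real ^ 'a" where "x = (\<chi> j. real k - 3 / 4)"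
  have "x \<in> cbox (?a 0) (?b 0)"
    using k by (auto simp: mem_box_cart x_def midpoint_family_nth slab_lower_def slab_upper_def)
  then obtain i where i: "i \<in> {1..N}" "x \<in> cbox (?a i) (?b i)"
    using cov unfolding covers_def by blast
  then have "real (p i) + real (q i) - 2 \<le> 2 * real k - 3 / 2"
    "2 * real k - 3 / 2 \<le> real (p i) + real (q i)"
    unfolding mem_box_cart x_def midpoint_family_nth slab_lower_def slab_upper_def
    by (auto dest!: spec[of _ j0])
  \<comment> \<open>Integrality sharpens the bounds: the sum is \<open>2 * k - 1\<close> or
    \<open>2 * k\<close>.\<close>
  then have meets: "p i + q i \<le> 2 * k" "2 * k \<le> p i + q i + 1"
    by linarith+
  show False
  proof (cases "p i = q i")
    case True
    with meets have "p i = k" "q i = k" by linarith+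
    \<comment> \<open>One of \<open>p\<close>, \<open>q\<close> takes the value \<open>k\<close> at
      \<open>i0\<close> too, so injectivity gives \<open>i = i0\<close>, where they
      disagree.\<close>
    with i0 show False
      using permutes_inj[OF p] permutes_inj[OF q] by (metis injD)
  next
    case False
    \<comment> \<open>Two distinct numbers, both at least \<open>k\<close>, have sum at least
      \<open>2 * k + 1\<close>.\<close>
    with least[of i] meets show False by linarith
  qed
qed

lemma inj_on_slab_transcript:
  assumes T: "correct_algorithm N T" and N: "N \<ge> 1"
  shows "inj_on (\<lambda>p. transcript T (slab_lower j0 p) (slab_upper N j0 p)) {p. p permutes {1..N}}"
proof (rule inj_onI, rule ccontr, unfold mem_Collect_eq)
  fix p q
  assume p: "p permutes {1..N}" and q: "q permutes {1..N}" and "p \<noteq> q"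
    and eq: "transcript T (slab_lower j0 p) (slab_upper N j0 p) =
             transcript T (slab_lower j0 q) (slab_upper N j0 q)"
  let ?a = "midpoint_family (slab_lower j0 p) (slab_lower j0 q)"
  let ?b = "midpoint_family (slab_upper N j0 p) (slab_upper N j0 q)"
  have "verdict T ?a ?b = verdict T (slab_lower j0 p) (slab_upper N j0 p)"
    by (rule verdict_eq_if_transcript_eq[OF transcript_midpoint_family[OF eq]])
  moreover have "admissible N ?a ?b"
    by (intro admissible_midpoint_family admissible_slabs p q N)
  \<comment> \<open>Correctness enters twice: the slabs cover, so the shared verdict is
    \<open>True\<close>; at the admissible midpoint this verdict asserts covering.\<close>
  ultimately have "covers N ?a ?b"
    using T admissible_slabs[OF p N] covers_slabs[OF p N] unfolding correct_algorithm_def by blast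
  then show False
    using not_covers_midpoint_slabs[OF p q \<open>p \<noteq> q\<close>] by blast
qed

section \<open>Counting answer sequences\<close>

lemma UNIV_answer: "UNIV = {Less, Equal, Greater}"
  using answer.exhaust by blast

text \<open>Transcripts may have different lengths, so all lengths up to \<open>h\<close> are
  counted. Base \<open>4\<close> absorbs the geometric sum: the induction step adds
  \<open>3 * 3 ^ h\<close>, at most \<open>3 * 4 ^ h\<close>.\<close>

lemma card_answer_lists_le:
  "finite {xs :: answer list. length xs \<le> h}" "card {xs :: answer list. length xs \<le> h} \<le> 4 ^ h"
proof -
  have answers: "finite (UNIV :: answer set)" "card (UNIV :: answer set) = 3"
    by (simp_all add: UNIV_answer)
  show "finite {xs :: answer list. length xs \<le> h}"
    using finite_lists_length_le[OF answers(1), of h] by simp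
  have "(\<Sum>i\<le>h. 3 ^ i) \<le> (4 ^ h :: nat)"
  proof (induction h)
    case (Suc h)
    have "(3::nat) ^ h \<le> 4 ^ h"
      by (rule power_mono) auto
    with Suc show ?case by simp
  qed simp
  then show "card {xs :: answer list. length xs \<le> h} \<le> 4 ^ h"
    using card_lists_length_le[OF answers(1), of h] answers(2) by simp
qed

lemma fact_le_power_num_queries:
  fixes T :: "'d::finite algorithm"
  assumes T: "correct_algorithm N T" and N: "N \<ge> 1"
  shows "\<exists>a b. admissible N a b \<and> fact N \<le> (4::nat) ^ num_queries T a b"
proof -
  \<comment> \<open>Any coordinate serves; one exists because types are nonempty, which is
    \<open>d \<ge> 1\<close>.\<close>
  fix j0 :: 'd
  let ?P = "{p. p permutes {1..N}}"
  let ?tr = "\<lambda>p. transcript T (slab_lower j0 p) (slab_upper N j0 p)"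
  \<comment> \<open>The hard input is a slab input whose transcript attains this maximum.\<close>
  define h where "h = Max ((\<lambda>p. length (?tr p)) ` ?P)"
  have P: "finite ?P" "card ?P = fact N"
    by (simp_all add: finite_permutations card_permutations)
  have "?P \<noteq> {}"
    using permutes_id by blast
  then have "h \<in> (\<lambda>p. length (?tr p)) ` ?P"
    unfolding h_def using P(1) by (intro Max_in) auto
  then obtain p where p: "p permutes {1..N}" "h = length (?tr p)"
    by blast
  have "?tr ` ?P \<subseteq> {xs. length xs \<le> h}"
    using P(1) by (auto simp: h_def)
  then have "fact N \<le> card {xs :: answer list. length xs \<le> h}"
    using card_inj_on_le[OF inj_on_slab_transcript[OF T N] _ card_answer_lists_le(1)] P(2) by simp
  also have "\<dots> \<le> 4 ^ h"
    by (rule card_answer_lists_le)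
  finally show ?thesis
    using admissible_slabs[OF p(1) N] p(2) by (metis length_transcript)
qed

section \<open>Asymptotics\<close>

text \<open>A weak Stirling bound. From \<open>n\<close> to \<open>n + 1\<close> the left side grows
  by at most \<open>ln (n + 1)\<close>, because \<open>ln (1 + 1/n) \<le> 1/n\<close> for
  \<open>n > 0\<close>.\<close>

lemma ln_fact_ge: "real n * ln (real n) - real n \<le> ln (fact n)"
proof (induction n)
  case (Suc n)
  show ?case
  proof (cases "n = 0")
    case False
    have "ln (real (Suc n) / real n) \<le> real (Suc n) / real n - 1"
      using False by (intro ln_le_minus_one) simp
    then have "real n * (ln (real (Suc n)) - ln (real n)) \<le> 1"
      using False by (simp add: ln_div field_simps)
    moreover have "ln (fact (Suc n)) = ln (real (Suc n)) + ln (fact n)"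
      by (simp add: ln_mult del: of_nat_Suc)
    ultimately show ?thesis
      using Suc by (simp add: algebra_simps)
  qed simp
qed simp

lemma num_queries_lower_bound:
  "\<forall>\<^sub>F N in sequentially. \<forall>T :: 'd::finite algorithm. correct_algorithm N T \<longrightarrow>
     (\<exists>a b. admissible N a b \<and>
        1 / (2 * ln 4) * real N * ln (real N) \<le> real (num_queries T a b))"
proof -
  \<comment> \<open>True once \<open>ln N \<ge> 2\<close>. Absorbing the linear term costs the
    factor \<open>2\<close> in the constant; \<open>ln 4\<close> comes from the counting
    base.\<close>
  have "\<forall>\<^sub>F N in sequentially. real N * ln (real N) / 2 \<le> real N * ln (real N) - real N"
    by real_asymp
  moreover have "\<forall>\<^sub>F N in sequentially. N \<ge> (1::nat)"
    by (rule eventually_ge_at_top)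
  ultimately show ?thesis
  proof eventually_elim
    case (elim N)
    show ?case
    proof (intro allI impI)
      fix T :: "'d algorithm"
      assume "correct_algorithm N T"
      then obtain a b where ab: "admissible N a b" "fact N \<le> (4::nat) ^ num_queries T a b"
        using fact_le_power_num_queries elim(2) by blast
      have "(fact N :: real) \<le> 4 ^ num_queries T a b"
        using ab(2) by (metis of_nat_fact of_nat_le_iff of_nat_numeral of_nat_power)
      then have "ln (fact N) \<le> real (num_queries T a b) * ln 4"
        by (metis fact_gt_zero ln_le_cancel_iff ln_realpow order_less_le_trans zero_less_numeral)
      with elim(1) ln_fact_ge[of N] have "real N * ln (real N) / 2 \<le> real (num_queries T a b) * ln 4"
        by linarith
      then have "1 / (2 * ln 4) * real N * ln (real N) \<le> real (num_queries T a b)"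
        by (simp add: field_simps)
      with ab(1) show "\<exists>a b. admissible N a b \<and>
          1 / (2 * ln 4) * real N * ln (real N) \<le> real (num_queries T a b)"
        by blast
    qed
  qed
qed

theorem theorem1:
  shows "\<not> (\<exists>(T :: nat \<Rightarrow> 'd::finite algorithm) (C :: real).
              (\<forall>N\<ge>1. correct_algorithm N (T N)) \<and>
              (\<forall>\<^sub>F N in sequentially. \<forall>a b. admissible N a b \<longrightarrow>
                 real (num_queries (T N) a b) \<le> C * real N)) \<and>
         (\<exists>c>0. \<forall>\<^sub>F N in sequentially. \<forall>T :: 'd algorithm. correct_algorithm N T \<longrightarrow>
           (\<exists>a b. admissible N a b \<and>
              c * real N * ln (real N) \<le> real (num_queries T a b)))"
proof (intro conjI notI)
  let ?c = "1 / (2 * ln 4) :: real"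
  have c: "?c > 0" by simp
  then show "\<exists>c>0. \<forall>\<^sub>F N in sequentially. \<forall>T :: 'd algorithm. correct_algorithm N T \<longrightarrow>
      (\<exists>a b. admissible N a b \<and> c * real N * ln (real N) \<le> real (num_queries T a b))"
    using num_queries_lower_bound by blast
  assume "\<exists>(T :: nat \<Rightarrow> 'd algorithm) (C :: real).
              (\<forall>N\<ge>1. correct_algorithm N (T N)) \<and>
              (\<forall>\<^sub>F N in sequentially. \<forall>a b. admissible N a b \<longrightarrow>
                 real (num_queries (T N) a b) \<le> C * real N)"
  then obtain T :: "nat \<Rightarrow> 'd algorithm" and C :: real
    where T: "\<And>N. N \<ge> 1 \<Longrightarrow> correct_algorithm N (T N)"
      and C: "\<forall>\<^sub>F N in sequentially. \<forall>a b. admissible N a b \<longrightarrow>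
                 real (num_queries (T N) a b) \<le> C * real N"
    by blast
  have "filterlim (\<lambda>N. ln (real N)) at_top sequentially"
    by real_asymp
  \<comment> \<open>Beyond this threshold \<open>?c * N * ln N\<close> exceeds \<open>C * N\<close>,
    so a linear upper bound contradicts the lower bound.\<close>
  then have "\<forall>\<^sub>F N in sequentially. C / ?c < ln (real N)"
    by (simp add: filterlim_at_top_dense)
  moreover have "\<forall>\<^sub>F N in sequentially. N \<ge> (1::nat)"
    by (rule eventually_ge_at_top)
  ultimately have "\<forall>\<^sub>F N :: nat in sequentially. False"
    using C num_queries_lower_bound[where 'd = 'd]
  proof eventually_elim
    case (elim N)
    then obtain a b where "admissible N a b"
      "?c * real N * ln (real N) \<le> real (num_queries (T N) a b)"
      using T by blast
    with elim(3) have "?c * real N * ln (real N) \<le> C * real N"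
      by fastforce
    then have "real N * (?c * ln (real N)) \<le> real N * C"
      by (simp add: mult_ac)
    then have "?c * ln (real N) \<le> C"
      using elim(2) by (subst (asm) mult_le_cancel_left_pos) auto
    moreover have "C < ?c * ln (real N)"
      using elim(1) c by (simp only: pos_divide_less_eq mult.commute)
    ultimately show False by linarith
  qed
  then show False by simp
qed

end
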